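(* Let $n\ge 3$ be an integer and let $x=[n,n,\ldots,n,\ldots]=\frac{n+\sqrt{n^2+4}}{2}$ be the $n$th metallic number (infinite regular continued fraction with all entries equal to $n$). Then the radius of convergence of the power series $[x]_q$ (in the complex variable $q$, centered at $0$) is greater than or equal to $R_{(1)}=\frac{3-\sqrt5}{2}$.
   Context: **Regular continued fractions.** $[a_1,a_2,\ldots,a_k]=a_1+\cfrac{1}{a_2+\cfrac{1}{\ddots+\cfrac{1}{a_k}}}$ with integers $a_i\ge 1$. Since $[a_1,\ldots,a_k]=[a_1,\ldots,a_k-1,1]$ (when $a_k\ge2$) and $[a_1,\ldots,a_{k-1},1]=[a_1,\ldots,a_{k-1}+1]$, every rational number $>1$ has a unique such expansion of even length $2m$. **$q$-integers.** $[0]_q=0$ and $[a]_q=1+q+\cdots+q^{a-1}$ for an integer $a\ge1$; $[a]_{q^{-1}}=1+q^{-1}+\cdots+q^{-(a-1)}$. **$q$-rationals (Morier-Genoud and Ovsienko).** For a rational $\frac rs=[a_1,\ldots,a_{2m}]>1$, $$\left[\frac rs\right]_q=[a_1]_q+\cfrac{q^{a_1}}{[a_2]_{q^{-1}}+\cfrac{q^{-a_2}}{[a_3]_q+\cfrac{q^{a_3}}{[a_4]_{q^{-1}}+\cfrac{q^{-a_4}}{\ddots+\cfrac{q^{a_{2m-1}}}{[a_{2m}]_{q^{-1}}}}}}},$$ a rational function of $q$, regarded as a power series in $q$ via its Taylor expansion at $q=0$. (For a positive integer this gives the $q$-integer; $[1]_q=1$.) **$q$-irrationals.** For an irrational $x>1$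 and any sequence of rationals $x_k\to x$, write $[x_k]_q=\sum_{s\ge0}\varkappa_{k,s}q^s$. It is known (Morier-Genoud and Ovsienko) that for each $s$ the coefficients $\varkappa_{k,s}$ stabilize as $k\to\infty$ to an integer $\varkappa_s$ that does not depend on the chosen sequence; one defines $[x]_q=\sum_{s\ge0}\varkappa_sq^s$. For $x=\frac{n+\sqrt{n^2+4}}2$ the series $[x]_q$ is called the $n$th $q$-metallic number; it satisfies $q[x]_q^2-\big((q-1)(q^n+1)+q[n]_q\big)[x]_q-1=0$. *)

theory Defs
  imports "HOL-Analysis.Analysis" "HOL-Computational_Algebra.Formal_Laurent_Series"
begin

section \<open>Regular continued fractions\<close>

fun cf :: "nat list \<Rightarrow> real" where
  "cf [] = 0"
| "cf [a] = real a"
| "cf (a # b # as) = real a + 1 / cf (b # as)"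

text \<open>The even-length regular continued fraction expansion of a rational number \<open>r > 1\<close>.\<close>

definition even_expansion :: "real \<Rightarrow> nat list" where
  "even_expansion r = (THE as. even (length as) \<and> (\<forall>a \<in> set as. a \<ge> 1) \<and> cf as = r)"


section \<open>q-deformations\<close>

definition q_int :: "'a::field \<Rightarrow> nat \<Rightarrow> 'a" where
  "q_int q a = (\<Sum>i<a. q ^ i)"

text \<open>The parameter is inverted from each level to the next, so for an even-length list
  the levels use \<open>q\<close>, \<open>q\<^sup>-\<^sup>1\<close>, \<open>q\<close>, and so on, the last one using \<open>q\<^sup>-\<^sup>1\<close>.\<close>

fun q_cf :: "'a::field \<Rightarrow> nat list \<Rightarrow> 'a" where
  "q_cf q [] = 0"
| "q_cf q [a] = q_int q a"
| "q_cf q (a # b # as) = q_int q a + q ^ a / q_cf (inverse q) (b # as)"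

text \<open>Rational functions of \<open>q\<close> form a subfield of the field of formal Laurent series, the
  embedding being the Laurent expansion at \<open>q = 0\<close>.  Evaluating \<^const>\<open>q_cf\<close> in that field at
  the indeterminate therefore yields the expansion of the rational function.  Taking the
  regular part discards nothing: see \<open>q_rational_Taylor\<close> below.\<close>

definition q_rational :: "real \<Rightarrow> complex fps" where
  "q_rational r = fls_regpart (q_cf fls_X (even_expansion r))"

definition stabilizes_to :: "(nat \<Rightarrow> complex fps) \<Rightarrow> complex fps \<Rightarrow> bool" where
  "stabilizes_to F G \<longleftrightarrow> (\<forall>s. \<forall>\<^sub>F k in sequentially. fps_nth (F k) s = fps_nth G s)"

text \<open>Only rationals above 1 have a q-deformation here.  Since \<open>x > 1\<close>, every sequence of rationals
  tending to \<open>x\<close> is eventually of this kind, so the restriction on \<open>X\<close> loses nothing.\<close>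

definition q_irrational :: "real \<Rightarrow> complex fps" where
  "q_irrational x = (THE G. \<forall>X. (\<forall>k. X k \<in> \<rat> \<and> X k > 1) \<longrightarrow> X \<longlonglongrightarrow> x
     \<longrightarrow> stabilizes_to (\<lambda>k. q_rational (X k)) G)"


section \<open>Consistency of the definitions\<close>

lemma cf_ge1: "as \<noteq> [] \<Longrightarrow> \<forall>a \<in> set as. a \<ge> 1 \<Longrightarrow> cf as \<ge> 1"
proof (induction as rule: cf.induct)
  case (3 a b as)
  then have "cf (b # as) \<ge> 1" "real a \<ge> 1" by auto
  then show ?case by (simp add: add_increasing2)
qed auto

lemma cf_gt1: "length as \<ge> 2 \<Longrightarrow> \<forall>a \<in> set as. a \<ge> 1 \<Longrightarrow> cf as > 1"
proof (induction as rule: cf.induct)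
  case (3 a b as)
  then have "cf (b # as) \<ge> 1" "real a \<ge> 1" using cf_ge1[of "b # as"] by auto
  then have "1 / cf (b # as) > 0" by simp
  then show ?case unfolding cf.simps using \<open>real a \<ge> 1\<close> by linarith
qed auto

lemma q_int_inverse:
  assumes "(q::'a::field) \<noteq> 0"
  shows "q ^ b * q_int (inverse q) b = q * q_int q b"
proof -
  have "q ^ b * q_int (inverse q) b = (\<Sum>i<b. q ^ b * inverse q ^ i)"
    by (simp add: q_int_def sum_distrib_left)
  also have "\<dots> = (\<Sum>i<b. q * q ^ (b - Suc i))"
  proof (rule sum.cong)
    fix i assume "i \<in> {..<b}"
    then have "b = Suc (b - Suc i) + i" by auto
    then have "q ^ b = q * q ^ (b - Suc i) * q ^ i" by (metis power_Suc power_add)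
    then show "q ^ b * inverse q ^ i = q * q ^ (b - Suc i)"
      using assms by (simp add: power_inverse)
  qed simp
  also have "\<dots> = (\<Sum>i<b. q * q ^ i)" by (rule sum.nat_diff_reindex)
  finally show ?thesis by (simp add: q_int_def sum_distrib_left)
qed

lemma q_int_fls_X: "b \<ge> 1 \<Longrightarrow>
  \<exists>F :: complex fps. fps_nth F 0 = 1 \<and> q_int fls_X b = fps_to_fls F"
proof (intro exI conjI)
  assume "b \<ge> 1"
  show "fps_nth (\<Sum>i<b. fps_X ^ i) 0 = (1::complex)"
    using \<open>b \<ge> 1\<close> by (simp add: fps_sum_nth if_distrib)
  show "q_int fls_X b = fps_to_fls (\<Sum>i<b. fps_X ^ i :: complex fps)"
    unfolding q_int_def by (induction b) (auto simp: fps_to_fls_power fls_plus_const)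
qed

lemma q_cf_fls_X: "even (length as) \<Longrightarrow> as \<noteq> [] \<Longrightarrow> \<forall>a \<in> set as. a \<ge> 1 \<Longrightarrow>
  \<exists>F :: complex fps. fps_nth F 0 = 1 \<and> q_cf fls_X as = fps_to_fls F"
proof (induction as rule: induct_list012)
  case (3 a b as)
  let ?X = "fls_X :: complex fls"
  obtain A :: "complex fps" where A: "fps_nth A 0 = 1" "q_int fls_X a = fps_to_fls A"
    using q_int_fls_X[of a] 3 by auto
  obtain B :: "complex fps" where B: "fps_nth B 0 = 1" "q_int fls_X b = fps_to_fls B"
    using q_int_fls_X[of b] 3 by auto
  have ab: "a \<ge> 1" "b \<ge> 1" using 3 by auto
  have X: "?X ^ b * q_int (inverse ?X) b = fps_to_fls (fps_X * B)"
    by (simp add: q_int_inverse B fls_times_fps_to_fls)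
  show ?case
  proof (cases as)
    case Nil
    let ?G = "A + fps_X ^ (a + b - 1) * inverse B"
    have "q_cf ?X (a # b # as) = q_int ?X a + ?X ^ a / q_int (inverse ?X) b"
      using Nil by simp
    also have "\<dots> = q_int ?X a + ?X ^ (a + b) / (?X ^ b * q_int (inverse ?X) b)"
      by (simp add: power_add)
    also have "\<dots> = fps_to_fls A + ?X * ?X ^ (a + b - 1) / (?X * fps_to_fls B)"
      unfolding X A using ab by (simp add: fls_times_fps_to_fls flip: power_Suc)
    also have "\<dots> = fps_to_fls A + ?X ^ (a + b - 1) * inverse (fps_to_fls B)"
      by (simp add: divide_inverse)
    also have "\<dots> = fps_to_fls ?G"
      using B by (simp add: fls_times_fps_to_fls fps_to_fls_power fls_inverse_fps_to_fls subdegree_eq_0)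
    finally have "q_cf ?X (a # b # as) = fps_to_fls ?G" .
    moreover have "fps_nth ?G 0 = 1" using A ab by simp
    ultimately show ?thesis by blast
  next
    case (Cons c cs)
    then obtain F :: "complex fps" where F: "fps_nth F 0 = 1" "q_cf fls_X as = fps_to_fls F"
      using 3 by auto
    let ?H = "fps_X * B + inverse F"
    let ?G = "A + fps_X ^ (a + b) * inverse ?H"
    have H: "fps_nth ?H 0 = 1" using F by simp
    have "q_cf ?X (a # b # as) =
        q_int ?X a + ?X ^ a / (q_int (inverse ?X) b + inverse ?X ^ b / q_cf ?X as)"
      using Cons by simp
    also have "\<dots> = q_int ?X a + ?X ^ (a + b) /
        (?X ^ b * (q_int (inverse ?X) b + inverse ?X ^ b / q_cf ?X as))"
      by (simp add: power_add)
    also have "?X ^ b * (q_int (inverse ?X) b + inverse ?X ^ b / q_cf ?X as) =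
        fps_to_fls (fps_X * B) + inverse (fps_to_fls F)"
      unfolding X[symmetric] F
      by (simp add: distrib_left divide_inverse power_inverse flip: mult.assoc)
    also have "\<dots> = fps_to_fls ?H"
      using F by (simp add: fls_inverse_fps_to_fls subdegree_eq_0)
    also have "q_int ?X a + ?X ^ (a + b) / fps_to_fls ?H = fps_to_fls ?G"
      using H unfolding A divide_inverse
      by (simp del: fps_to_fls_plus
          add: fps_to_fls_plus[of A] fls_times_fps_to_fls fps_to_fls_power fls_inverse_fps_to_fls subdegree_eq_0)
    finally have "q_cf ?X (a # b # as) = fps_to_fls ?G" .
    moreover have "fps_nth ?G 0 = 1" using A ab by simp
    ultimately show ?thesis by blast
  qed
qed auto

lemma cf_unique:
  assumes "as \<noteq> []" "bs \<noteq> []" "\<forall>a \<in> set as. a \<ge> 1" "\<forall>b \<in> set bs. b \<ge> 1"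
    and "even (length as) = even (length bs)" "cf as = cf bs"
  shows "as = bs"
proof -
  have no_int: "cf (b # c # cs) \<noteq> real a"
    if "\<forall>x \<in> set (b # c # cs). x \<ge> 1" "odd (length (b # c # cs))" for a b c cs
  proof
    assume eq: "cf (b # c # cs) = real a"
    have "length (c # cs) \<ge> 2" using that(2) by (cases cs) auto
    then have "cf (c # cs) > 1" using that(1) cf_gt1[of "c # cs"] by auto
    then have "0 < 1 / cf (c # cs)" "1 / cf (c # cs) < 1" by auto
    then have "real b < real a" "real a < real b + 1" using eq unfolding cf.simps by linarith+
    then have "b < a" "a < Suc b" by linarith+
    then show False by simp
  qed
  have lt: "cf (a # b # as) < cf (c # d # ds)"
    if "\<forall>x \<in> set (b # as). x \<ge> 1" "\<forall>x \<in> set (d # ds). x \<ge> 1" "a < c" for a b c d as ds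
  proof -
    have "cf (b # as) \<ge> 1" "cf (d # ds) \<ge> 1" using that cf_ge1 by blast+
    then have "1 / cf (b # as) \<le> 1" "1 / cf (d # ds) > 0" by auto
    moreover have "real a + 1 \<le> real c" using that by linarith
    ultimately show ?thesis unfolding cf.simps by linarith
  qed
  show ?thesis using assms
  proof (induction as arbitrary: bs rule: cf.induct)
    case (2 a)
    then obtain b bs' where bs: "bs = b # bs'" by (cases bs) auto
    show ?case
    proof (cases bs')
      case (Cons c cs)
      then show ?thesis using no_int[of b c cs a] 2 bs by auto
    qed (use 2 bs in auto)
  next
    case (3 a b as)
    then obtain c bs' where bs: "bs = c # bs'" by (cases bs) auto
    show ?case
    proof (cases bs')
      case Nil
      then show ?thesis using no_int[of a b as c] 3 bs by auto
    next
      case (Cons d ds)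
      have "a = c"
        using lt[of b as d ds a c] lt[of d ds b as c a] 3 bs Cons by (cases a c rule: linorder_cases) auto
      then have "b # as = d # ds"
        using 3 bs Cons by (intro "3.IH") auto
      then show ?thesis using \<open>a = c\<close> bs Cons by simp
    qed
  qed auto
qed

lemma cf_exists:
  assumes "q \<ge> 1" "p \<ge> q"
  shows "(\<exists>as. odd (length as) \<and> (\<forall>a \<in> set as. a \<ge> 1) \<and> cf as = real p / real q) \<and>
    (p > q \<longrightarrow> (\<exists>as. even (length as) \<and> (\<forall>a \<in> set as. a \<ge> 1) \<and> cf as = real p / real q))"
  using assms
proof (induction q arbitrary: p rule: less_induct)
  case (less q)
  let ?a = "p div q" let ?s = "p mod q"
  have p: "p = ?a * q + ?s" by simp
  have a1: "?a \<ge> 1" using less.prems by (simp add: div_greater_zero_iff Suc_leI)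
  show ?case
  proof (cases "?s = 0")
    case True
    then have pq: "real p / real q = real ?a" by (simp add: real_of_nat_div mod_eq_0_iff_dvd)
    have "?a \<ge> 2" if "p > q"
    proof (rule ccontr)
      assume "\<not> ?a \<ge> 2"
      then have "?a = 1" using a1 by linarith
      with p True have "p = q" by simp
      with that show False by simp
    qed
    then have "even (length [?a - 1, 1]) \<and> (\<forall>a \<in> set [?a - 1, 1]. a \<ge> 1)
        \<and> cf [?a - 1, 1] = real p / real q" if "p > q"
      using pq that by (auto simp: of_nat_diff)
    moreover have "odd (length [?a]) \<and> (\<forall>a \<in> set [?a]. a \<ge> 1) \<and> cf [?a] = real p / real q"
      using a1 pq by simp
    ultimately show ?thesis by blast
  next
    case False
    then have sq: "?s < q" "?s \<ge> 1" "?s \<le> q" using less.prems by auto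
    have "real p = real ?a * real q + real ?s" by (metis p of_nat_add of_nat_mult)
    then have pq: "real p / real q = real ?a + 1 / (real q / real ?s)"
      using less.prems False by (simp add: field_simps)
    have step: "\<exists>bs. (even (length bs) \<longleftrightarrow> odd (length as)) \<and> (\<forall>a \<in> set bs. a \<ge> 1)
        \<and> cf bs = real p / real q"
      if "\<forall>a \<in> set as. a \<ge> 1" "cf as = real q / real ?s" for as
    proof -
      have "real q / real ?s > 0" using False less.prems by (intro divide_pos_pos) linarith+
      then have "as \<noteq> []" using that by auto
      then obtain b cs where "as = b # cs" by (cases as) auto
      then show ?thesis using that a1 pq by (intro exI[of _ "?a # as"]) auto
    qed
    show ?thesis using less.IH[OF sq] step sq(1) by metis
  qed
qed

lemma ex1_even_expansion:
  assumes "r \<in> \<rat>" "r > 1"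
  shows "\<exists>!as. even (length as) \<and> (\<forall>a \<in> set as. a \<ge> 1) \<and> cf as = r"
proof -
  obtain i j :: int where ij: "j > 0" "r = of_int i / of_int j"
    using assms(1) by (auto elim!: Rats_cases')
  then have "real_of_int i > real_of_int j" using assms(2) by (simp add: less_divide_eq)
  then have "i > j" by simp
  then have "real (nat i) / real (nat j) = r" "nat j \<ge> 1" "nat i > nat j" "nat i \<ge> nat j" using ij by auto
  then obtain as where "even (length as)" "\<forall>a \<in> set as. a \<ge> 1" "cf as = r"
    using cf_exists[of "nat j" "nat i"] by metis
  moreover have "bs \<noteq> []" if "cf bs = r" for bs using that assms by auto
  ultimately show ?thesis using cf_unique by (intro ex1I[of _ as]) metis+
qed

lemma q_rational_Taylor:
  assumes "r \<in> \<rat>" "r > 1"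
  shows "fps_to_fls (q_rational r) = q_cf fls_X (even_expansion r)"
proof -
  have *: "even (length (even_expansion r)) \<and> (\<forall>a \<in> set (even_expansion r). a \<ge> 1)
      \<and> cf (even_expansion r) = r"
    unfolding even_expansion_def by (rule theI') (rule ex1_even_expansion[OF assms])
  then have "even_expansion r \<noteq> []" using assms by auto
  with * obtain F :: "complex fps" where "q_cf fls_X (even_expansion r) = fps_to_fls F"
    using q_cf_fls_X by blast
  then show ?thesis by (simp add: q_rational_def)
qed

lemma metallic_continued_fraction:
  fixes n :: nat
  assumes "n \<ge> 1"
  shows "(\<lambda>k. cf (replicate (Suc k) n)) \<longlonglongrightarrow> (real n + sqrt (real n ^ 2 + 4)) / 2"
proof -
  define x where "x = (real n + sqrt (real n ^ 2 + 4)) / 2"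
  define c where "c k = cf (replicate (Suc k) n)" for k
  have "sqrt (real n ^ 2 + 4) > sqrt (1 ^ 2)"
    by (rule real_sqrt_less_mono) (simp add: add_pos_nonneg add.commute less_add_same_cancel1 add_strict_increasing)
  then have "sqrt (real n ^ 2 + 4) > 1" by simp
  moreover have "real n \<ge> 1" using assms by simp
  ultimately have "real n + sqrt (real n ^ 2 + 4) > 1 + 1" by (intro add_le_less_mono)
  then have x1: "x > 1" by (simp add: x_def)
  have "2 * x - real n = sqrt (real n ^ 2 + 4)" by (simp add: x_def field_simps)
  then have "(2 * x - real n) ^ 2 = real n ^ 2 + 4" by simp
  then have "x * x = real n * x + 1" by (simp add: power2_eq_square algebra_simps)
  then have xeq: "x = real n + 1 / x" using x1 by (simp add: field_simps)
  have cS: "c (Suc k) = real n + 1 / c k" for k by (simp add: c_def)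
  have c1: "c k \<ge> 1" for k unfolding c_def by (rule cf_ge1) (use assms in auto)
  have bound: "\<bar>c k - x\<bar> \<le> \<bar>c 0 - x\<bar> * (1 / x) ^ k" for k
  proof (induction k)
    case (Suc k)
    have "c (Suc k) - x = 1 / c k - 1 / x" using cS[of k] xeq by linarith
    also have "\<dots> = (x - c k) / (c k * x)" using c1[of k] x1 by (simp add: field_simps)
    finally have "c (Suc k) - x = (x - c k) / (c k * x)" .
    then have "\<bar>c (Suc k) - x\<bar> = \<bar>x - c k\<bar> / \<bar>c k * x\<bar>" by (simp only: abs_divide)
    also have "\<dots> = \<bar>c k - x\<bar> / (c k * x)"
    proof -
      have "c k * x \<ge> 0" using c1[of k] x1 by (intro mult_nonneg_nonneg) linarith+
      then show ?thesis by (simp only: abs_minus_commute[of x] abs_of_nonneg)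
    qed
    also have "\<dots> \<le> \<bar>c k - x\<bar> / x"
    proof (intro divide_left_mono)
      show "x \<le> c k * x" using mult_right_mono[of 1 "c k" x] c1[of k] x1 by simp
      then show "0 < c k * x * x" using x1 c1[of k] by (intro mult_pos_pos) linarith+
    qed simp
    also have "\<dots> \<le> \<bar>c 0 - x\<bar> * (1 / x) ^ k / x"
      using Suc x1 by (intro divide_right_mono) auto
    finally show ?case by (simp only: power_Suc2 times_divide_eq_right mult_1_right)
  qed simp
  have "(\<lambda>k. \<bar>c 0 - x\<bar> * (1 / x) ^ k) \<longlonglongrightarrow> \<bar>c 0 - x\<bar> * 0"
    by (intro tendsto_mult tendsto_const LIMSEQ_realpow_zero) (use x1 in auto)
  then have lim: "(\<lambda>k. \<bar>c 0 - x\<bar> * (1 / x) ^ k) \<longlonglongrightarrow> 0" by (simp only: mult_zero_right)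
  have "(\<lambda>k. c k - x) \<longlonglongrightarrow> 0"
  proof (rule Lim_null_comparison[OF _ lim])
    show "\<forall>\<^sub>F k in sequentially. norm (c k - x) \<le> \<bar>c 0 - x\<bar> * (1 / x) ^ k"
      using bound by (intro always_eventually allI) (simp only: real_norm_def)
  qed
  then have "c \<longlonglongrightarrow> x" by (rule LIM_zero_cancel)
  then show ?thesis by (simp only: c_def[abs_def] x_def)
qed

end

theory Submission
  imports Defs "HOL-Complex_Analysis.Complex_Analysis"
begin

text \<open>
  Two levels of the q-continued fraction with entries \<open>a\<close>, \<open>b\<close> act on power series by
  \<open>F \<mapsto> [a] + q^(a+b) / (q [b] + 1/F)\<close>, a contraction of order \<open>a + b\<close> in the q-adic metric. Hence
  the metallic q-number is the fixed point of this map for \<open>a = b = n\<close>, which is a root of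
  \<open>q G^2 - B G - 1\<close> with \<open>B = (q - 1)(q^n + 1) + q [n]\<close>. Its discriminant is
  \<open>B^2 + 4 q = 1 + 2 q^2 + O(q^3)\<close> and stays at distance less than 1 from 1 on the disc of radius
  0.39, so that the principal square root gives an analytic solution there.
\<close>

section \<open>The q-continued fraction as a contraction\<close>

text \<open>\<open>q_int\<close> lives over fields only, so power series get their own copy of
  [a].\<close>

definition fps_q_int :: "nat \<Rightarrow> complex fps" where
  "fps_q_int a = (\<Sum>i<a. fps_X ^ i)"

text \<open>Scaling the inner denominator by q^b turns [b] at 1/q plus q^(-b)/F into q [b] + 1/F. No
  negative powers remain, and for F with constant coefficient 1 both inverses are genuine.\<close>

definition q_cf_step :: "nat \<Rightarrow> nat \<Rightarrow> complex fps \<Rightarrow> complex fps" where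
  "q_cf_step a b F = fps_q_int a + fps_X ^ (a + b) * inverse (fps_X * fps_q_int b + inverse F)"

lemma q_int_fls_X_eq: "q_int fls_X a = fps_to_fls (fps_q_int a)"
  unfolding q_int_def fps_q_int_def
  by (induction a) (auto simp: fps_to_fls_power fls_plus_const)

lemma geometric_fps_q_int: "(fps_X - 1) * fps_q_int a = fps_X ^ a - 1"
  by (induction a) (auto simp: fps_q_int_def algebra_simps)

lemma inverses_diff:
  fixes u v :: "'a :: comm_ring_1"
  assumes "u * u' = 1" "v * v' = 1"
  shows "u' - v' = (v - u) * (u' * v')"
proof -
  have "(v - u) * (u' * v') = u' * (v * v') - v' * (u * u')"
    by (simp add: algebra_simps)
  then show ?thesis by (simp add: assms)
qed

text \<open>With H and K the two denominators, 1/H - 1/K = (K - H)/(HK) and K - H = (F - G)/(FG).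
  The difference of the images is thus q^(a+b) (F - G) times a unit.\<close>

lemma q_cf_step_cong_mod_X:
  assumes "fps_nth F 0 = 1" "fps_nth G 0 = 1" "fps_X ^ N dvd F - G"
  shows "fps_X ^ (N + a + b) dvd q_cf_step a b F - q_cf_step a b G"
proof -
  define H K where "H = fps_X * fps_q_int b + inverse F" "K = fps_X * fps_q_int b + inverse G"
  have FG: "F * inverse F = 1" "G * inverse G = 1"
    using assms by (simp_all add: inverse_mult_eq_1')
  have "fps_nth H 0 = 1" "fps_nth K 0 = 1"
    using assms by (simp_all add: H_K_def)
  then have HK: "H * inverse H = 1" "K * inverse K = 1"
    by (simp_all add: inverse_mult_eq_1')
  have "K - H = (F - G) * (inverse F * inverse G)"
    using inverses_diff[OF FG(2,1)] by (simp add: H_K_def mult.commute)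
  moreover have "inverse H - inverse K = (K - H) * (inverse H * inverse K)"
    using inverses_diff[OF HK] .
  moreover have "q_cf_step a b F - q_cf_step a b G = fps_X ^ (a + b) * (inverse H - inverse K)"
    by (simp add: q_cf_step_def H_K_def right_diff_distrib)
  ultimately have "q_cf_step a b F - q_cf_step a b G =
      (fps_X ^ (a + b) * (F - G)) * (inverse F * inverse G * (inverse H * inverse K))"
    by (simp only: mult.assoc mult.commute mult.left_commute)
  moreover have "fps_X ^ (N + a + b) dvd fps_X ^ (a + b) * (F - G)"
    using assms(3) by (simp add: power_add mult_ac mult_dvd_mono)
  ultimately show ?thesis by simp
qed

lemma q_cf_Cons_Cons:
  assumes "a \<ge> 1" "b \<ge> 1" "as \<noteq> []" "q_cf fls_X as = fps_to_fls F" "fps_nth F 0 = 1"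
  shows "q_cf fls_X (a # b # as) = fps_to_fls (q_cf_step a b F)"
proof -
  let ?X = "fls_X :: complex fls"
  define H where "H = fps_X * fps_q_int b + inverse F"
  have H0: "fps_nth H 0 = 1"
    using assms by (simp add: H_def)
  have "q_cf ?X (a # b # as) =
      q_int ?X a + ?X ^ a / (q_int (inverse ?X) b + inverse ?X ^ b / q_cf ?X as)"
    using assms(3) by (cases as) simp_all
  \<comment> \<open>Numerator and denominator are multiplied by \<open>?X ^ b\<close>, which makes
    the denominator the power series \<open>H\<close>.\<close>
  also have "\<dots> = q_int ?X a + ?X ^ (a + b) /
      (?X ^ b * (q_int (inverse ?X) b + inverse ?X ^ b / q_cf ?X as))"
    by (simp add: power_add)
  also have "?X ^ b * (q_int (inverse ?X) b + inverse ?X ^ b / q_cf ?X as) =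
      ?X ^ b * q_int (inverse ?X) b + inverse (fps_to_fls F)"
    unfolding assms(4) by (simp add: distrib_left divide_inverse power_inverse flip: mult.assoc)
  also have "\<dots> = fps_to_fls H"
    using assms(5)
    by (simp add: H_def q_int_inverse q_int_fls_X_eq fls_times_fps_to_fls fls_inverse_fps_to_fls
        subdegree_eq_0)
  also have "q_int ?X a + ?X ^ (a + b) / fps_to_fls H = fps_to_fls (q_cf_step a b F)"
    using H0 unfolding q_int_fls_X_eq divide_inverse q_cf_step_def H_def[symmetric]
    by (simp add: fls_times_fps_to_fls fps_to_fls_power fls_inverse_fps_to_fls subdegree_eq_0)
  finally show ?thesis .
qed

lemma
  assumes "r \<in> \<rat>" "r > 1"
  shows even_expansion_props: "even (length (even_expansion r))"
      "\<forall>a \<in> set (even_expansion r). a \<ge> 1" "cf (even_expansion r) = r"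
    and even_expansion_nonempty: "even_expansion r \<noteq> []"
proof -
  have *: "even (length (even_expansion r)) \<and> (\<forall>a \<in> set (even_expansion r). a \<ge> 1)
      \<and> cf (even_expansion r) = r"
    unfolding even_expansion_def by (rule theI') (rule ex1_even_expansion[OF assms])
  then show "even (length (even_expansion r))"
    "\<forall>a \<in> set (even_expansion r). a \<ge> 1" "cf (even_expansion r) = r" by auto
  then show "even_expansion r \<noteq> []" using assms by auto
qed

lemma q_rational_nth_0:
  assumes "r \<in> \<rat>" "r > 1"
  shows "fps_nth (q_rational r) 0 = 1"
  using q_cf_fls_X[of "even_expansion r"] even_expansion_props[OF assms]
    even_expansion_nonempty[OF assms] q_rational_Taylor[OF assms]
  by fastforce

text \<open>Prepending two entries preserves even length, so by uniqueness
  \<open>a # b # even_expansion r\<close> is the even expansion of the new number.\<close>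

lemma q_rational_Cons_Cons:
  assumes "r \<in> \<rat>" "r > 1" "a \<ge> 1" "b \<ge> 1"
  shows "q_rational (real a + 1 / (real b + 1 / r)) = q_cf_step a b (q_rational r)"
proof -
  let ?as = "even_expansion r" and ?s = "real a + 1 / (real b + 1 / r)"
  note as = even_expansion_props[OF assms(1,2)] even_expansion_nonempty[OF assms(1,2)]
  have s: "?s \<in> \<rat>" "?s > 1"
  proof -
    have "0 < 1 / (real b + 1 / r)"
      using assms by (auto intro!: divide_pos_pos add_nonneg_pos)
    moreover have "real a \<ge> 1" using assms by simp
    ultimately show "?s > 1" by linarith
  qed (use assms in auto)
  have "cf (a # b # ?as) = ?s"
    using as by (cases ?as) simp_all
  then have "even_expansion ?s = a # b # ?as"
    using as assms(3,4) unfolding even_expansion_def[of ?s]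
    by (intro the1_equality ex1_even_expansion s) auto
  then have "fps_to_fls (q_rational ?s) = q_cf fls_X (a # b # ?as)"
    using q_rational_Taylor[OF s] by simp
  also have "\<dots> = fps_to_fls (q_cf_step a b (q_rational r))"
    using assms as q_rational_Taylor[OF assms(1,2)] q_rational_nth_0[OF assms(1,2)]
    by (intro q_cf_Cons_Cons) auto
  finally show ?thesis by simp
qed

section \<open>q-deformed quadratic irrationals\<close>

text \<open>The real map r \<mapsto> a + 1/(b + 1/r) fixes x and has the inverse g, continuous at x.
  A rational r near x is the image of g r, which is again near x and above 1, so the contraction
  improves the congruence for g r by a + b \<ge> 1 powers of q. Induction on k makes the agreement
  with G arbitrarily good.\<close>

lemma eventually_q_rational_cong:
  fixes x :: real
  assumes x: "x > 1" "x = real a + 1 / (real b + 1 / x)" and ab: "a \<ge> 1" "b \<ge> 1"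
    and G: "fps_nth G 0 = 1" "q_cf_step a b G = G"
  shows "\<forall>\<^sub>F r in nhds x. r \<in> \<rat> \<longrightarrow> fps_X ^ k dvd q_rational r - G"
proof (induction k)
  case (Suc k)
  define g where "g t = 1 / (1 / (t - real a) - real b)" for t
  have "real b + 1 / x > 0" using x(1) by (simp add: add_nonneg_pos)
  moreover have "x - real a = 1 / (real b + 1 / x)"
    using x(2) by linarith
  ultimately have xa: "x - real a \<noteq> 0" "1 / (x - real a) - real b = 1 / x"
    by simp_all
  then have gx: "g x = x" by (simp add: g_def)
  have cont: "isCont g x" "isCont (\<lambda>t. 1 / (t - real a) - real b) x"
    unfolding g_def using xa x(1) by (auto intro!: continuous_intros)
  then have g: "filterlim g (nhds x) (nhds x)"
    using gx by (metis filterlim_def isCont_def tendsto_at_iff_tendsto_nhds)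
  have "\<forall>\<^sub>F r in nhds x. 1 < g r"
    using g x(1) by (rule order_tendstoD)
  moreover have "\<forall>\<^sub>F r in nhds x. g r \<in> \<rat> \<longrightarrow> fps_X ^ k dvd q_rational (g r) - G"
    using filterlim_iff[THEN iffD1, OF g] Suc by blast
  moreover have "\<forall>\<^sub>F r in nhds x. r \<noteq> real a"
    using xa by (intro t1_space_nhds) auto
  ultimately show ?case
  proof eventually_elim
    case (elim r)
    show ?case
    proof
      assume "r \<in> \<rat>"
      then have gr: "g r \<in> \<rat>" by (auto simp: g_def)
      \<comment> \<open>Division by zero yields 0, so \<open>1 < g r\<close> excludes a vanishing
        denominator.\<close>
      have "1 / (r - real a) - real b \<noteq> 0" using elim(1) by (auto simp: g_def)
      then have "real a + 1 / (real b + 1 / g r) = r"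
        using elim by (simp add: g_def)
      then have "q_rational r = q_cf_step a b (q_rational (g r))"
        using q_rational_Cons_Cons[OF gr elim(1) ab] by simp
      moreover have "fps_X ^ (k + a + b) dvd
          q_cf_step a b (q_rational (g r)) - q_cf_step a b G"
        using gr elim q_rational_nth_0 G by (intro q_cf_step_cong_mod_X) auto
      moreover have "fps_X ^ Suc k dvd (fps_X ^ (k + a + b) :: complex fps)"
        using ab by (intro le_imp_power_dvd) simp
      ultimately show "fps_X ^ Suc k dvd q_rational r - G"
        using G(2) by (metis dvd_trans)
    qed
  qed
qed simp

lemma fps_X_power_dvd_imp_nth_eq:
  fixes F G :: "'a :: comm_ring_1 fps"
  assumes "fps_X ^ N dvd F - G" "s < N"
  shows "fps_nth F s = fps_nth G s"
proof -
  obtain H where "F - G = fps_X ^ N * H" using assms(1) by (elim dvdE)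
  then have "fps_nth (F - G) s = 0" using assms(2) by (simp add: fps_X_power_mult_nth)
  then show ?thesis by simp
qed

lemma q_irrational_eq_fixed_point:
  fixes x :: real
  assumes x: "x > 1" "x = real a + 1 / (real b + 1 / x)" and ab: "a \<ge> 1" "b \<ge> 1"
    and G: "fps_nth G 0 = 1" "q_cf_step a b G = G"
  shows "q_irrational x = G"
  unfolding q_irrational_def
proof (rule the_equality)
  show stab: "\<forall>X. (\<forall>k. X k \<in> \<rat> \<and> X k > 1) \<longrightarrow> X \<longlonglongrightarrow> x \<longrightarrow> stabilizes_to (\<lambda>k. q_rational (X k)) G"
    unfolding stabilizes_to_def
  proof (intro allI impI)
    fix X :: "nat \<Rightarrow> real" and s
    assume X: "\<forall>k. X k \<in> \<rat> \<and> X k > 1" "X \<longlonglongrightarrow> x"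
    have "\<forall>\<^sub>F k in sequentially. X k \<in> \<rat> \<longrightarrow> fps_X ^ Suc s dvd q_rational (X k) - G"
      using filterlim_iff[THEN iffD1, OF X(2)] eventually_q_rational_cong[OF assms] by blast
    then show "\<forall>\<^sub>F k in sequentially. fps_nth (q_rational (X k)) s = fps_nth G s"
      by eventually_elim (use X fps_X_power_dvd_imp_nth_eq in blast)
  qed
  fix G'
  assume G': "\<forall>X. (\<forall>k. X k \<in> \<rat> \<and> X k > 1) \<longrightarrow> X \<longlonglongrightarrow> x \<longrightarrow> stabilizes_to (\<lambda>k. q_rational (X k)) G'"
  \<comment> \<open>Uniqueness requires one actual admissible sequence, otherwise the condition on
    G' could hold vacuously. Approaching x from above keeps the terms larger than 1.\<close>
  have "\<exists>r \<in> \<rat>. x < r \<and> r < x + 1 / real (Suc k)" for k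
    using Rats_dense_in_real[of x "x + 1 / real (Suc k)"] by auto
  then obtain X where X: "\<And>k. X k \<in> \<rat>" "\<And>k. x < X k" "\<And>k. X k < x + 1 / real (Suc k)"
    by metis
  have "(\<lambda>k. x + 1 / real (Suc k)) \<longlonglongrightarrow> x + 0"
    by (intro tendsto_intros LIMSEQ_Suc[OF lim_1_over_n])
  then have lim: "X \<longlonglongrightarrow> x"
    by (intro tendsto_sandwich[of "\<lambda>_. x" X _ "\<lambda>k. x + 1 / real (Suc k)"] always_eventually allI)
      (use X in \<open>auto intro: less_imp_le simp del: of_nat_Suc\<close>)
  have X1: "\<forall>k. X k \<in> \<rat> \<and> X k > 1"
    using X x(1) by (meson less_trans)
  show "G' = G"
  proof (rule fps_ext)
    fix s
    have "\<forall>\<^sub>F k in sequentially. fps_nth (q_rational (X k)) s = fps_nth G s"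
      "\<forall>\<^sub>F k in sequentially. fps_nth (q_rational (X k)) s = fps_nth G' s"
      using stab G' lim X1 unfolding stabilizes_to_def by blast+
    then have "\<forall>\<^sub>F k in sequentially. fps_nth G' s = fps_nth G s"
      by eventually_elim simp
    then show "fps_nth G' s = fps_nth G s" by simp
  qed
qed

section \<open>The quadratic equation and its discriminant\<close>

definition metallic_coeff :: "nat \<Rightarrow> complex fps" where
  "metallic_coeff n = (fps_X - 1) * (fps_X ^ n + 1) + fps_X * fps_q_int n"

text \<open>Clearing denominators in the fixed point equation gives A = [n] times the quadratic.
  This rests on A B = q A^2 + q^(2n) - 1 for B = \<open>metallic_coeff n\<close>, a consequence of
  (q - 1) A = q^n - 1.\<close>

lemma q_cf_step_metallic_root:
  assumes "fps_nth G 0 = 1" and "fps_X * G\<^sup>2 - metallic_coeff n * G - 1 = 0"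
  shows "q_cf_step n n G = G"
proof -
  define A where "A = fps_q_int n"
  define H where "H = fps_X * A + inverse G"
  have G: "G * inverse G = 1" using assms by (simp add: inverse_mult_eq_1')
  have "fps_nth H 0 = 1" using assms by (simp add: H_def)
  then have H: "H * inverse H = 1" by (simp add: inverse_mult_eq_1')
  have A: "(fps_X - 1) * A = fps_X ^ n - 1" by (simp add: A_def geometric_fps_q_int)
  have AB: "A * metallic_coeff n = fps_X * A\<^sup>2 + fps_X ^ (n + n) - 1"
  proof -
    have "A * metallic_coeff n = ((fps_X - 1) * A) * (fps_X ^ n + 1) + fps_X * A\<^sup>2"
      unfolding metallic_coeff_def A_def[symmetric] by (simp add: algebra_simps power2_eq_square)
    then show ?thesis unfolding A by (simp add: algebra_simps power_add)
  qed
  have "G * ((G - A) * H - fps_X ^ (n + n)) = (G - A) * (fps_X * A * G + G * inverse G) - fps_X ^ (n + n) * G"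
    by (simp add: H_def algebra_simps)
  also have "\<dots> = fps_X * A * G\<^sup>2 - (fps_X * A\<^sup>2 + fps_X ^ (n + n) - 1) * G - A"
    unfolding G by (simp add: algebra_simps power2_eq_square)
  also have "\<dots> = A * (fps_X * G\<^sup>2 - metallic_coeff n * G - 1)"
    unfolding AB[symmetric] by (simp add: algebra_simps)
  \<comment> \<open>The quadratic vanishes and the nonzero factor G cancels.\<close>
  finally have "(G - A) * H = fps_X ^ (n + n)"
    using assms by auto
  then have "G - A = fps_X ^ (n + n) * inverse H"
    using H by (metis mult.assoc mult.right_neutral)
  then show ?thesis
    unfolding q_cf_step_def A_def[symmetric] H_def[symmetric] by (simp add: algebra_simps)
qed

section \<open>The discriminant as an analytic function and its square root\<close>

definition metallic_disc :: "nat \<Rightarrow> complex \<Rightarrow> complex" where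
  "metallic_disc n z = ((z - 1) * (z ^ n + 1) + z * (\<Sum>i<n. z ^ i))\<^sup>2 + 4 * z"

text \<open>For n \<ge> 3 the base of the square is 2z - 1 + z^2 + U with U of order z^3. As (2z -
  1)^2 + 4z = 1 + 4z^2, the linear terms cancel, and crude bounds on the rest add up to about 0.965.
  The radius 39/100 lies just above (3 - sqrt 5)/2 = 0.3819...\<close>

lemma metallic_disc_near_1:
  assumes "n \<ge> 3" "norm z < 39 / 100"
  shows "norm (metallic_disc n z - 1) < 1"
proof -
  define r where "r = norm z"
  have r: "0 \<le> r" "r \<le> 39 / 100" using assms by (auto simp: r_def)
  obtain m where n: "n = m + 3" using assms(1) by (metis add.commute le_Suc_ex)
  define Q where "Q = (\<Sum>i<m. z ^ i)"
  define U where "U = z ^ 3 * (Q + z ^ (m + 1))"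
  define T where "T = z ^ 2 + U"
  have Q: "(\<Sum>i<n. z ^ i) = 1 + z * (1 + z * (Q + z ^ m))"
  proof -
    have shift: "(\<Sum>i<Suc k. z ^ i) = 1 + z * (\<Sum>i<k. z ^ i)" for k
      by (simp add: sum.lessThan_Suc_shift sum_distrib_left del: sum.lessThan_Suc)
    have "n = Suc (Suc (Suc m))" by (simp add: n)
    then show ?thesis by (simp only: shift[of "Suc (Suc m)"] shift[of "Suc m"]) (simp add: Q_def)
  qed
  \<comment> \<open>The two terms z^n cancel, which is why U contains Q and z^(m+1) but not
    z^m.\<close>
  have "(z - 1) * (z ^ n + 1) + z * (\<Sum>i<n. z ^ i) = 2 * z - 1 + T"
    unfolding Q unfolding T_def U_def n by (simp add: algebra_simps power_add eval_nat_numeral)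
  then have disc: "metallic_disc n z - 1 = 2 * z ^ 2 - 2 * U + 4 * z * T + T ^ 2"
    unfolding metallic_disc_def by (simp add: T_def power2_eq_square algebra_simps)
  have "norm Q \<le> (\<Sum>i<m. r ^ i)"
    unfolding Q_def r_def by (rule order.trans[OF norm_sum]) (simp add: norm_power)
  also have "\<dots> = (1 - r ^ m) / (1 - r)"
    using r by (simp add: sum_gp_strict)
  finally have "norm (Q + z ^ (m + 1)) \<le> (1 - r ^ m) / (1 - r) + r ^ (m + 1)"
    by (intro order.trans[OF norm_triangle_ineq] add_mono) (simp_all add: norm_power norm_mult r_def)
  \<comment> \<open>Only distinct powers of r occur, so the full geometric series 1/(1 - r) is an
    upper bound.\<close>
  also have "\<dots> = (1 - r ^ m * (1 - r * (1 - r))) / (1 - r)"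
    using r by (simp add: field_simps)
  also have "\<dots> \<le> 1 / (1 - r)"
    using r by (intro divide_right_mono) (auto simp: mult_le_one)
  also have "\<dots> \<le> 100 / 61"
    using r by (simp add: field_simps)
  finally have "norm U \<le> r ^ 3 * (100 / 61)"
    unfolding U_def norm_mult norm_power r_def by (intro mult_left_mono) auto
  also have "\<dots> \<le> (39 / 100) ^ 3 * (100 / 61)"
    using r by (intro mult_right_mono power_mono) auto
  finally have U: "norm U \<le> 1 / 10" by (simp add: eval_nat_numeral)
  have z2: "norm (z ^ 2) \<le> 153 / 1000"
  proof -
    have "r ^ 2 \<le> (39 / 100) ^ 2" using r by (intro power_mono)
    then show ?thesis by (simp add: norm_power norm_mult r_def power2_eq_square)
  qed
  have T: "norm T \<le> 253 / 1000"
    unfolding T_def by (rule order.trans[OF norm_triangle_ineq]) (use U z2 in simp)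
  have zT: "norm (z * T) \<le> 39 / 100 * (253 / 1000)"
    unfolding norm_mult using T r by (intro mult_mono) (auto simp: r_def)
  have T2: "norm (T ^ 2) \<le> (253 / 1000) ^ 2"
    unfolding norm_power using T by (intro power_mono) auto
  have "norm (2 * z ^ 2 - 2 * U + 4 * z * T + T ^ 2) \<le>
      2 * norm (z ^ 2) + 2 * norm U + 4 * norm (z * T) + norm (T ^ 2)"
    by (intro order.trans[OF norm_triangle_ineq] order.trans[OF norm_triangle_ineq4] add_mono)
      (simp_all add: norm_mult)
  also have "\<dots> < 1"
    using U z2 zT T2 by (simp add: power2_eq_square)
  finally show ?thesis unfolding disc .
qed

lemma has_fps_expansion_metallic_disc:
  "metallic_disc n has_fps_expansion (metallic_coeff n)\<^sup>2 + 4 * fps_X"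
  unfolding metallic_disc_def[abs_def] metallic_coeff_def fps_q_int_def numeral_fps_const
  by (intro fps_expansion_intros)

text \<open>Distance less than 1 from 1 keeps the discriminant off the branch cut of
  \<open>csqrt\<close>, so the root is holomorphic on the disc and its Taylor series converges
  there. Uniqueness of expansions turns the identity of functions into one of formal series.\<close>

lemma metallic_disc_fps_sqrt:
  assumes "n \<ge> 3"
  obtains S where "S\<^sup>2 = (metallic_coeff n)\<^sup>2 + 4 * fps_X" "fps_nth S 0 = 1"
    "fps_conv_radius S \<ge> ereal (39 / 100)"
proof
  let ?f = "\<lambda>z. csqrt (metallic_disc n z)"
  let ?S = "fps_expansion ?f 0"
  have "metallic_disc n z \<notin> \<real>\<^sub>\<le>\<^sub>0" if "norm z < 39 / 100" for z
    using metallic_disc_near_1[OF assms that] complex_Re_le_cmod[of "1 - metallic_disc n z"]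
    by (auto simp: complex_nonpos_Reals_iff norm_minus_commute)
  then have hol: "?f holomorphic_on ball 0 (39 / 100)"
    by (auto intro!: holomorphic_intros simp: metallic_disc_def[abs_def])
  then show "fps_conv_radius ?S \<ge> ereal (39 / 100)"
    by (intro conv_radius_fps_expansion) auto
  have exp: "?f has_fps_expansion ?S"
    using hol by (intro has_fps_expansion_fps_expansion[of "ball 0 (39 / 100)"]) auto
  have "(\<lambda>z. (?f z)\<^sup>2) has_fps_expansion ?S\<^sup>2"
    by (intro fps_expansion_intros exp)
  then have "metallic_disc n has_fps_expansion ?S\<^sup>2"
    by simp
  then show "?S\<^sup>2 = (metallic_coeff n)\<^sup>2 + 4 * fps_X"
    using has_fps_expansion_metallic_disc fps_expansion_unique_complex by blast
  have "metallic_disc n 0 = 1"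
    using assms by (simp add: metallic_disc_def power_0_left)
  then show "fps_nth ?S 0 = 1"
    using has_fps_expansion_imp_0_eq_fps_nth_0[OF exp] by simp
qed

section \<open>The analytic root of the quadratic equation\<close>

theorem theorem1p2:
  fixes n :: nat and x :: real
  assumes "n \<ge> 3"
    and "x = (real n + sqrt (real n ^ 2 + 4)) / 2"
  shows "fps_conv_radius (q_irrational x) \<ge> ereal ((3 - sqrt 5) / 2)"
proof -
  let ?B = "metallic_coeff n"
  obtain S where S: "S\<^sup>2 = ?B\<^sup>2 + 4 * fps_X" "fps_nth S 0 = 1"
    "fps_conv_radius S \<ge> ereal (39 / 100)"
    using metallic_disc_fps_sqrt[OF assms(1)] .
  \<comment> \<open>This is the root (B + S)/(2q). The shift is an exact division by q because the
    constant coefficients -1 of B and 1 of S cancel.\<close>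
  define G where "G = fps_const (1 / 2) * fps_shift 1 (?B + S)"
  have B0: "fps_nth ?B 0 = -1" "fps_nth ?B 1 = 2"
    using assms(1)
    by (simp_all add: metallic_coeff_def fps_q_int_def fps_sum_nth fps_X_power_nth algebra_simps)
  \<comment> \<open>Comparing coefficients of q gives 2 s = -4 + 4 for the linear coefficient s of
    S. Hence s = 0 and G has constant coefficient (2 + 0)/2 = 1.\<close>
  have "fps_nth (S\<^sup>2) 1 = fps_nth (?B\<^sup>2 + 4 * fps_X) 1"
    using S(1) by simp
  then have G0: "fps_nth G 0 = 1"
    using S(2) B0 by (simp add: G_def power2_eq_square fps_mult_nth numeral_fps_const)
  have "fps_const (2 * (1 / 2)) * (fps_X * fps_shift 1 (?B + S)) = ?B + S"
    using S(2) B0 by (intro fps_ext) (simp split: nat.splits)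
  then have XG: "2 * (fps_X * G) - ?B = S"
    by (simp only: G_def numeral_fps_const mult_ac flip: fps_const_mult) simp
  \<comment> \<open>Completing the square; the factor 4q is then cancelled in the integral domain of
    power series.\<close>
  have "4 * fps_X * (fps_X * G\<^sup>2 - ?B * G - 1) = (2 * (fps_X * G) - ?B)\<^sup>2 - (?B\<^sup>2 + 4 * fps_X)"
    by (simp add: power2_eq_square algebra_simps)
  then have root: "fps_X * G\<^sup>2 - ?B * G - 1 = 0"
    unfolding XG S(1) by (simp add: numeral_fps_const)
  have rad_q: "fps_conv_radius (fps_q_int n) \<ge> \<infinity>"
    unfolding fps_q_int_def
  proof (induction n)
    case (Suc n)
    then show ?case unfolding sum.lessThan_Suc by (intro fps_conv_radius_add_ge) simp_all
  qed simp
  have rad_B: "fps_conv_radius ?B \<ge> \<infinity>"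
    unfolding metallic_coeff_def
    by (intro fps_conv_radius_add_ge fps_conv_radius_mult_ge fps_conv_radius_diff_ge rad_q) auto
  have "fps_conv_radius (?B + S) \<ge> ereal (39 / 100)"
    using S(3) rad_B by (intro fps_conv_radius_add_ge) auto
  then have "fps_conv_radius G \<ge> ereal (39 / 100)"
    by (simp add: G_def fps_conv_radius_cmult_left)
  moreover have "q_irrational x = G"
  proof (rule q_irrational_eq_fixed_point)
    have "x \<ge> real n / 2" unfolding assms(2) by (intro divide_right_mono) simp_all
    moreover have "real n \<ge> 3" using assms(1) by simp
    ultimately show "x > 1" by linarith
    have "(2 * x - real n)\<^sup>2 = real n ^ 2 + 4"
      unfolding assms(2) by (simp add: field_simps)
    then have "x * x = real n * x + 1" by (simp add: power2_eq_square algebra_simps)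
    then have "x = real n + 1 / x" using \<open>x > 1\<close> by (simp add: field_simps)
    then show "x = real n + 1 / (real n + 1 / x)" by metis
  qed (use assms G0 root q_cf_step_metallic_root in auto)
  \<comment> \<open>Chosen so that (3 - 222/100)/2 is exactly 39/100.\<close>
  moreover have "sqrt 5 \<ge> 222 / 100"
    by (rule real_le_rsqrt) (simp add: power2_eq_square)
  then have "ereal ((3 - sqrt 5) / 2) \<le> ereal (39 / 100)" by simp
  ultimately show ?thesis by (metis order.trans)
qed

end
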